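(* Let $h\ge1$, let $m_1,\dots,m_h,n_1,\dots,n_h$ be positive integers, and let $G=\mathrm{DNG}(m_1,\ldots,m_h;n_1,\ldots,n_h)$ be a chain graph. Then every vertex in $U_1\cup U_h\cup V_1\cup V_h$ is a downer vertex for every non-zero eigenvalue of $G$.
   Context: All graphs are simple; eigenvalues of a graph are those of its adjacency matrix. The chain (double nested) graph $\mathrm{DNG}(m_1,\ldots,m_h;n_1,\ldots,n_h)$ is the bipartite graph with color classes $U=U_1\cup\cdots\cup U_h$ and $V=V_1\cup\cdots\cup V_h$ (disjoint unions, $|U_i|=m_i$, $|V_i|=n_i$) in which a vertex $u\in U_i$ is adjacent to a vertex $v\in V_j$ if and only if $j\le h-i+1$; there are no edges inside $U$ or inside $V$. For an eigenvalue $\lambda$ of a graph $G$ of multiplicity $k\ge1$ and a vertex $v$, $v$ is a downer vertex for $\lambda$ if the multiplicity of $\lambda$ as an eigenvalue of $G-v$ is $k-1$. *)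

theory Defs
  imports "Graph_Theory.Pair_Digraph" "Jordan_Normal_Form.Char_Poly"
begin

text \<open>Simple graphs are the finite symmetric loop-free digraphs of the locale \<^locale>\<open>graph\<close>.\<close>

section \<open>Eigenvalues of a graph\<close>

definition adjacency_matrix :: "'a list \<Rightarrow> ('a, 'b) pre_digraph \<Rightarrow> real mat" where
  "adjacency_matrix vs G = mat (length vs) (length vs)
     (\<lambda>(i, j). if vs ! i \<rightarrow>\<^bsub>G\<^esub> vs ! j then 1 else 0)"

text \<open>The rows and columns are labelled by an arbitrary enumeration of the vertices;
  lemmas \<open>graph_eigenvalue_eq\<close> and \<open>eigenvalue_multiplicity_eq\<close> below
  show that the choice is irrelevant.\<close>

definition vertex_enum :: "('a, 'b) pre_digraph \<Rightarrow> 'a list" where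
  "vertex_enum G = (SOME vs. distinct vs \<and> set vs = verts G)"

definition graph_eigenvalue :: "('a, 'b) pre_digraph \<Rightarrow> real \<Rightarrow> bool" where
  "graph_eigenvalue G x \<longleftrightarrow> eigenvalue (adjacency_matrix (vertex_enum G) G) x"

text \<open>Only real eigenvalues occur and the algebraic multiplicity agrees with the geometric one,
  since the adjacency matrix of a simple graph is real symmetric.\<close>

definition eigenvalue_multiplicity :: "('a, 'b) pre_digraph \<Rightarrow> real \<Rightarrow> nat" where
  "eigenvalue_multiplicity G x =
     Polynomial.order x (char_poly (adjacency_matrix (vertex_enum G) G))"

definition downer_vertex :: "('a, 'b) pre_digraph \<Rightarrow> real \<Rightarrow> 'a \<Rightarrow> bool" where
  "downer_vertex G x v \<longleftrightarrow> v \<in> verts G \<and> graph_eigenvalue G x \<and>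
     eigenvalue_multiplicity (pre_digraph.del_vert G v) x = eigenvalue_multiplicity G x - 1"

lemma vertex_enum:
  assumes "finite (verts G)"
  shows "distinct (vertex_enum G)" "set (vertex_enum G) = verts G"
proof -
  have "\<exists>vs. distinct vs \<and> set vs = verts G"
    using finite_distinct_list[OF assms] by blast
  then have "distinct (vertex_enum G) \<and> set (vertex_enum G) = verts G"
    unfolding vertex_enum_def by (rule someI_ex)
  then show "distinct (vertex_enum G)" "set (vertex_enum G) = verts G" by simp_all
qed

lemma adjacency_matrix_carrier [simp]:
  "adjacency_matrix vs G \<in> carrier_mat (length vs) (length vs)"
  by (simp add: adjacency_matrix_def)

lemma adjacency_matrix_similar:
  assumes "distinct vs" "distinct ws" "set vs = set ws"
  shows "similar_mat (adjacency_matrix vs G) (adjacency_matrix ws G)"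
proof -
  define n where "n = length vs"
  have n': "length ws = n"
    unfolding n_def using assms by (metis distinct_card)
  define perm :: "'a list \<Rightarrow> 'a list \<Rightarrow> real mat" where
    "perm = (\<lambda>xs ys. mat n n (\<lambda>(i, j). if xs ! i = ys ! j then 1 else 0))"
  have carr: "perm xs ys \<in> carrier_mat n n" for xs ys
    by (simp add: perm_def)
  have collapse: "(\<Sum>j = 0..<n. (if xs ! i = ys ! j then 1 else 0) * f (ys ! j)) = f (xs ! i)"
    if a: "i < n" "length xs = n" "length ys = n" "distinct ys" "set xs = set ys"
    for xs ys i and f :: "'a \<Rightarrow> real"
  proof -
    have "xs ! i \<in> set ys"
      using a(1,2,5) nth_mem[of i xs] by simp
    then obtain k where k: "k < n" "ys ! k = xs ! i"
      using a(3) by (auto simp: in_set_conv_nth)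
    have "(\<Sum>j = 0..<n. (if xs ! i = ys ! j then 1 else 0) * f (ys ! j))
        = (\<Sum>j = 0..<n. if j = k then f (xs ! i) else 0)"
    proof (rule sum.cong)
      fix j assume "j \<in> {0..<n}"
      then have "xs ! i = ys ! j \<longleftrightarrow> j = k"
        using nth_eq_iff_index_eq[OF a(4), of k j] a(3) k by auto
      then show "(if xs ! i = ys ! j then 1 else 0) * f (ys ! j) = (if j = k then f (xs ! i) else 0)"
        by auto
    qed simp
    also have "\<dots> = f (xs ! i)" using k by simp
    finally show ?thesis .
  qed
  have inv: "perm xs ys * perm ys xs = 1\<^sub>m n"
    if "length xs = n" "length ys = n" "distinct xs" "distinct ys" "set xs = set ys" for xs ys
  proof (rule eq_matI)
    fix i k assume "i < dim_row (1\<^sub>m n :: real mat)" "k < dim_col (1\<^sub>m n :: real mat)"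
    then have ik: "i < n" "k < n" by simp_all
    have "(perm xs ys * perm ys xs) $$ (i, k) =
        (\<Sum>j = 0..<n. (if xs ! i = ys ! j then 1 else 0) * (if ys ! j = xs ! k then 1 else 0))"
      using ik by (simp add: perm_def scalar_prod_def)
    also have "\<dots> = (if xs ! i = xs ! k then 1 else 0)"
      using that ik by (intro collapse[where f = "\<lambda>y. if y = xs ! k then 1 else 0"])
    finally show "(perm xs ys * perm ys xs) $$ (i, k) = 1\<^sub>m n $$ (i, k)"
      using ik that by (simp add: nth_eq_iff_index_eq)
  qed (simp_all add: perm_def)
  have conj: "adjacency_matrix vs G = perm vs ws * adjacency_matrix ws G * perm ws vs"
  proof (rule eq_matI)
    fix i k assume "i < dim_row (perm vs ws * adjacency_matrix ws G * perm ws vs)"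
      "k < dim_col (perm vs ws * adjacency_matrix ws G * perm ws vs)"
    then have ik: "i < n" "k < n" by (simp_all add: perm_def)
    have left: "(perm vs ws * adjacency_matrix ws G) $$ (i, j) =
        (if vs ! i \<rightarrow>\<^bsub>G\<^esub> ws ! j then 1 else 0)" if "j < n" for j
    proof -
      have "(perm vs ws * adjacency_matrix ws G) $$ (i, j) =
        (\<Sum>l = 0..<n. (if vs ! i = ws ! l then 1 else 0) * (if ws ! l \<rightarrow>\<^bsub>G\<^esub> ws ! j then 1 else 0))"
        using ik that n' by (simp add: perm_def adjacency_matrix_def scalar_prod_def)
      also have "\<dots> = (if vs ! i \<rightarrow>\<^bsub>G\<^esub> ws ! j then 1 else 0)"
        using ik n' n_def assms
        by (intro collapse[where f = "\<lambda>y. if y \<rightarrow>\<^bsub>G\<^esub> ws ! j then 1 else 0"]) auto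
      finally show ?thesis .
    qed
    have "(perm vs ws * adjacency_matrix ws G * perm ws vs) $$ (i, k) =
        (\<Sum>j = 0..<n. (perm vs ws * adjacency_matrix ws G) $$ (i, j) * perm ws vs $$ (j, k))"
      using ik n' by (simp add: perm_def adjacency_matrix_def scalar_prod_def)
    also have "\<dots> = (\<Sum>j = 0..<n. (if vs ! k = ws ! j then 1 else 0) *
        (if vs ! i \<rightarrow>\<^bsub>G\<^esub> ws ! j then 1 else 0))"
    proof (rule sum.cong[OF refl])
      fix j assume "j \<in> {0..<n}"
      then have j: "j < n" by simp
      have "perm ws vs $$ (j, k) = (if vs ! k = ws ! j then 1 else 0)"
        using ik j by (auto simp: perm_def)
      then show "(perm vs ws * adjacency_matrix ws G) $$ (i, j) * perm ws vs $$ (j, k) =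
          (if vs ! k = ws ! j then 1 else 0) * (if vs ! i \<rightarrow>\<^bsub>G\<^esub> ws ! j then 1 else 0)"
        unfolding left[OF j] by (simp only: mult.commute)
    qed
    also have "\<dots> = (if vs ! i \<rightarrow>\<^bsub>G\<^esub> vs ! k then 1 else 0)"
      using ik n' n_def assms
      by (intro collapse[where f = "\<lambda>y. if vs ! i \<rightarrow>\<^bsub>G\<^esub> y then 1 else 0"]) auto
    finally show "adjacency_matrix vs G $$ (i, k) =
        (perm vs ws * adjacency_matrix ws G * perm ws vs) $$ (i, k)"
      using ik by (simp add: adjacency_matrix_def n_def)
  qed (simp_all add: perm_def adjacency_matrix_def n_def)
  show ?thesis
  proof (rule similar_matI)
    show "{adjacency_matrix vs G, adjacency_matrix ws G, perm vs ws, perm ws vs}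
        \<subseteq> carrier_mat n n"
      using carr adjacency_matrix_carrier[of vs G] adjacency_matrix_carrier[of ws G] n'
      by (simp add: n_def)
    show "perm vs ws * perm ws vs = 1\<^sub>m n" "perm ws vs * perm vs ws = 1\<^sub>m n"
      using inv[of vs ws] inv[of ws vs] assms n' n_def[symmetric] by simp_all
  qed (rule conj)
qed

lemma eigenvalue_multiplicity_eq:
  assumes "distinct vs" "set vs = verts G"
  shows "eigenvalue_multiplicity G x = Polynomial.order x (char_poly (adjacency_matrix vs G))"
proof -
  have "finite (verts G)" using assms(2) by (metis finite_set)
  then have "similar_mat (adjacency_matrix (vertex_enum G) G) (adjacency_matrix vs G)"
    using vertex_enum[of G] assms by (intro adjacency_matrix_similar) auto
  then show ?thesis by (simp add: eigenvalue_multiplicity_def char_poly_similar)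
qed

lemma graph_eigenvalue_eq:
  assumes "distinct vs" "set vs = verts G"
  shows "graph_eigenvalue G x \<longleftrightarrow> eigenvalue (adjacency_matrix vs G) x"
proof -
  have "finite (verts G)" using assms(2) by (metis finite_set)
  then have "similar_mat (adjacency_matrix (vertex_enum G) G) (adjacency_matrix vs G)"
    using vertex_enum[of G] assms by (intro adjacency_matrix_similar) auto
  then have "char_poly (adjacency_matrix (vertex_enum G) G) = char_poly (adjacency_matrix vs G)"
    by (rule char_poly_similar)
  then show ?thesis
    by (simp add: graph_eigenvalue_def eigenvalue_root_char_poly[OF adjacency_matrix_carrier])
qed

section \<open>Chain graphs\<close>

text \<open>\<open>UVert i k\<close> and \<open>VVert i k\<close> are the \<open>k\<close>-th vertices
  (\<open>k\<close> counted from 0) of the cells \<open>U\<^sub>i\<close> and \<open>V\<^sub>i\<close>, where \<open>1 \<le> i \<le> h\<close>.\<close>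

datatype dng_vertex = UVert nat nat | VVert nat nat

definition U_cell :: "(nat \<Rightarrow> nat) \<Rightarrow> nat \<Rightarrow> dng_vertex set" where
  "U_cell m i = UVert i ` {..<m i}"

definition V_cell :: "(nat \<Rightarrow> nat) \<Rightarrow> nat \<Rightarrow> dng_vertex set" where
  "V_cell n i = VVert i ` {..<n i}"

definition DNG_edges :: "nat \<Rightarrow> (nat \<Rightarrow> nat) \<Rightarrow> (nat \<Rightarrow> nat) \<Rightarrow> dng_vertex rel" where
  "DNG_edges h m n = (\<Union>i\<in>{1..h}. \<Union>j\<in>{1..h - i + 1}. U_cell m i \<times> V_cell n j)"

text \<open>\<open>DNG h m n\<close> is \<open>DNG(m\<^sub>1,\<dots>,m\<^sub>h;n\<^sub>1,\<dots>,n\<^sub>h)\<close>; the values of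
  \<open>m\<close> and \<open>n\<close> outside \<open>{1..h}\<close> play no role.\<close>

definition DNG :: "nat \<Rightarrow> (nat \<Rightarrow> nat) \<Rightarrow> (nat \<Rightarrow> nat) \<Rightarrow> (dng_vertex, dng_vertex \<times> dng_vertex) pre_digraph"
  where "DNG h m n = with_proj
    \<lparr> pverts = (\<Union>i\<in>{1..h}. U_cell m i) \<union> (\<Union>j\<in>{1..h}. V_cell n j),
      parcs = DNG_edges h m n \<union> (DNG_edges h m n)\<inverse> \<rparr>"

lemma UVert_in_cell [simp]: "UVert i k \<in> U_cell m j \<longleftrightarrow> i = j \<and> k < m i" "UVert i k \<notin> V_cell n j"
  by (auto simp: U_cell_def V_cell_def)

lemma VVert_in_cell [simp]: "VVert i k \<in> V_cell n j \<longleftrightarrow> i = j \<and> k < n i" "VVert i k \<notin> U_cell m j"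
  by (auto simp: U_cell_def V_cell_def)

lemma DNG_adjacent_iff:
  assumes "i \<in> {1..h}" "j \<in> {1..h}" "u \<in> U_cell m i" "v \<in> V_cell n j"
  shows "u \<rightarrow>\<^bsub>DNG h m n\<^esub> v \<longleftrightarrow> j \<le> h - i + 1" "v \<rightarrow>\<^bsub>DNG h m n\<^esub> u \<longleftrightarrow> j \<le> h - i + 1"
  using assms by (cases u; cases v; auto simp: DNG_def DNG_edges_def)+

lemma DNG_not_adjacent:
  shows "\<lbrakk>u \<in> U_cell m i; u' \<in> U_cell m i'\<rbrakk> \<Longrightarrow> \<not> u \<rightarrow>\<^bsub>DNG h m n\<^esub> u'"
    and "\<lbrakk>v \<in> V_cell n j; v' \<in> V_cell n j'\<rbrakk> \<Longrightarrow> \<not> v \<rightarrow>\<^bsub>DNG h m n\<^esub> v'"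
  by (cases u; cases u'; auto simp: DNG_def DNG_edges_def)
    (cases v; cases v'; auto simp: DNG_def DNG_edges_def)

lemma graph_DNG: "graph (DNG h m n)"
proof -
  have *: "pair_graph \<lparr> pverts = P, parcs = E \<rparr>"
    if "finite P" "E \<subseteq> P \<times> P" "\<And>x. (x, x) \<notin> E" "sym E" for P :: "dng_vertex set" and E
  proof -
    have "finite E" using that by (meson finite_SigmaI finite_subset)
    then show ?thesis
      using that by unfold_locales (auto simp: symmetric_def)
  qed
  have "pair_graph \<lparr> pverts = (\<Union>i\<in>{1..h}. U_cell m i) \<union> (\<Union>j\<in>{1..h}. V_cell n j),
      parcs = DNG_edges h m n \<union> (DNG_edges h m n)\<inverse> \<rparr>" (is "pair_graph \<lparr> pverts = ?P, parcs = ?E \<rparr>")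
  proof (rule *)
    show "finite ?P" by (auto simp: U_cell_def V_cell_def)
    have "DNG_edges h m n \<subseteq> ?P \<times> ?P" unfolding DNG_edges_def by fastforce
    then show "?E \<subseteq> ?P \<times> ?P" by blast
    show "(x, x) \<notin> ?E" for x by (cases x) (auto simp: DNG_edges_def)
    show "sym ?E" by (auto simp: sym_def)
  qed
  then show ?thesis unfolding DNG_def by (rule pair_graph.pair_graphD_graph)
qed

end

theory Submission
  imports Defs
begin

text \<open>
  An eigenfunction for \<open>x \<noteq> 0\<close> is constant on the cells, say \<open>a\<^sub>i\<close> on \<open>U\<^sub>i\<close> and \<open>b\<^sub>j\<close> on \<open>V\<^sub>j\<close>,
  and subtracting consecutive eigenequations gives
  \<open>x (a\<^sub>i - a\<^sub>i\<^sub>+\<^sub>1) = n\<^sub>k b\<^sub>k\<close> and \<open>x (b\<^sub>i - b\<^sub>i\<^sub>+\<^sub>1) = m\<^sub>k a\<^sub>k\<close> with \<open>k = h + 1 - i\<close>.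
  If it vanishes on one of the four extreme cells, this recurrence makes it vanish
  everywhere. Hence an eigenfunction is non-zero at every extreme vertex \<open>v\<close>. This forces \<open>x\<close> not to be
  an eigenvalue of \<open>G - v\<close>, since an eigenfunction of \<open>G - v\<close>, extended by \<open>0\<close>, would be one of
  \<open>G\<close>. It also forces \<open>x\<close> to be a simple root of the characteristic polynomial: the adjugate \<open>B\<close> of
  \<open>x I - A\<close> is symmetric of rank one with \<open>B\<^sub>v\<^sub>v \<noteq> 0\<close>, so its trace, which is the derivative of the
  characteristic polynomial at \<open>x\<close>, is non-zero.
\<close>

section \<open>Simple eigenvalues of symmetric matrices\<close>

text \<open>By \<open>nz\<close>, reading off coordinate \<open>i\<close> is injective on the
  eigenspace, so any two eigenvectors are proportional. Symmetry then makes the adjugate of x I - A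
  a multiple of the outer product of one eigenvector with itself, and its trace a nonzero multiple
  of a sum of squares.\<close>

lemma simple_eigenvalue_if_eigenvectors_nonzero_at:
  fixes A :: "real mat"
  assumes A: "A \<in> carrier_mat N N" and sym: "A\<^sup>T = A" and i: "i < N"
    and ev: "eigenvalue A x"
    and nz: "\<And>y. \<lbrakk>y \<in> carrier_vec N; A *\<^sub>v y = x \<cdot>\<^sub>v y; y $ i = 0\<rbrakk> \<Longrightarrow> y = 0\<^sub>v N"
    and del: "\<not> eigenvalue (mat_delete A i i) x"
  shows "Polynomial.order x (char_poly A) = 1"
proof -
  \<comment> \<open>\<open>char_matrix A x\<close> is A - x I, so \<open>M\<close> is x I - A and
    its determinant is the characteristic polynomial at \<open>x\<close>.\<close>
  define M where "M = - char_matrix A x"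
  define B where "B = adj_mat M"
  have M: "M \<in> carrier_mat N N" using A by (simp add: M_def)
  have B: "B \<in> carrier_mat N N" and MB: "M * B = det M \<cdot>\<^sub>m 1\<^sub>m N" and BM: "B * M = det M \<cdot>\<^sub>m 1\<^sub>m N"
    using adj_mat[OF M] by (simp_all add: B_def)
  have root: "poly (char_poly A) x = 0"
    using ev A by (simp add: eigenvalue_root_char_poly)
  then have det: "det M = 0"
    using A by (simp add: char_poly_matrix[OF A] M_def)
  have kernel: "A *\<^sub>v y = x \<cdot>\<^sub>v y" if y: "y \<in> carrier_vec N" and My: "M *\<^sub>v y = 0\<^sub>v N" for y
  proof (rule eq_vecI)
    fix k assume "k < dim_vec (x \<cdot>\<^sub>v y)"
    then have k: "k < N" using y by simp
    have "row M k = x \<cdot>\<^sub>v unit_vec N k - row A k"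
      using A k by (intro eq_vecI) (auto simp: M_def char_matrix_def)
    then have "(M *\<^sub>v y) $ k = x * y $ k - row A k \<bullet> y"
      using M A y k by (simp add: minus_scalar_prod_distrib[of _ N])
    then show "(A *\<^sub>v y) $ k = (x \<cdot>\<^sub>v y) $ k"
      using My A y k by simp
  qed (use A y in simp)
  have zero_at: "y = 0\<^sub>v N" if "y \<in> carrier_vec N" "M *\<^sub>v y = 0\<^sub>v N" "y $ i = 0" for y
    using nz kernel that by blast
  have M_sym: "M\<^sup>T = M"
  proof (rule eq_matI)
    fix k l assume "k < dim_row M" "l < dim_col M"
    moreover from this have "A $$ (l, k) = A $$ (k, l)"
      using M A by (subst sym[symmetric]) auto
    ultimately show "M\<^sup>T $$ (k, l) = M $$ (k, l)"
      using A M by (auto simp: M_def char_matrix_def)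
  qed (use M in auto)
  have col: "M *\<^sub>v col B w = 0\<^sub>v N" if w: "w < N" for w
  proof -
    have "M *\<^sub>v col B w = col (M * B) w" using col_mult2[OF M B w] by simp
    then show ?thesis using w by (auto simp: MB det)
  qed
  define a where "a = col B i"
  define r where "r = row B i"
  have a: "a \<in> carrier_vec N" "M *\<^sub>v a = 0\<^sub>v N" using B i col by (auto simp: a_def)
  have r: "r \<in> carrier_vec N" using B i by (auto simp: r_def)
  \<comment> \<open>Transposing B M = 0 puts the rows of \<open>B\<close> in the kernel too, because
    \<open>M\<close> is symmetric.\<close>
  have Mr: "M *\<^sub>v r = 0\<^sub>v N"
  proof -
    have "M\<^sup>T *\<^sub>v row B i = col (M\<^sup>T * B\<^sup>T) i"
      using col_mult2[of "M\<^sup>T" N N "B\<^sup>T" N i] M B i by simp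
    also have "M\<^sup>T * B\<^sup>T = (B * M)\<^sup>T" using transpose_mult[OF B M] by simp
    finally show ?thesis using i by (auto simp: BM det M_sym r_def)
  qed
  \<comment> \<open>The combination of \<open>u\<close> and \<open>w\<close> that cancels coordinate
    \<open>i\<close> is a kernel vector, hence zero.\<close>
  have proportional: "u $ i * w $ k = w $ i * u $ k"
    if "u \<in> carrier_vec N" "M *\<^sub>v u = 0\<^sub>v N" "w \<in> carrier_vec N" "M *\<^sub>v w = 0\<^sub>v N" "k < N" for u w k
  proof -
    have "u $ i \<cdot>\<^sub>v w - w $ i \<cdot>\<^sub>v u \<in> carrier_vec N" using that by simp
    moreover have "M *\<^sub>v (u $ i \<cdot>\<^sub>v w - w $ i \<cdot>\<^sub>v u) = 0\<^sub>v N"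
      using that M by (auto simp: mult_minus_distrib_mat_vec[of _ N N] mult_mat_vec[of _ N N])
    moreover have "(u $ i \<cdot>\<^sub>v w - w $ i \<cdot>\<^sub>v u) $ i = 0" using that i by simp
    ultimately have "u $ i \<cdot>\<^sub>v w - w $ i \<cdot>\<^sub>v u = 0\<^sub>v N" by (rule zero_at)
    then have "(u $ i \<cdot>\<^sub>v w - w $ i \<cdot>\<^sub>v u) $ k = 0" using that by simp
    then show ?thesis using that by simp
  qed
  \<comment> \<open>Diagonal cofactors carry the sign +1, so they are principal minors of
    \<open>M\<close>.\<close>
  have char_del: "poly (char_poly (mat_delete A k k)) x = B $$ (k, k)" if k: "k < N" for k
  proof -
    have "mat_delete A k k \<in> carrier_mat (N - 1) (N - 1)" using A mat_delete_carrier by blast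
    moreover have "mat_delete M k k = - char_matrix (mat_delete A k k) x"
      using A k by (intro eq_matI) (auto simp: M_def char_matrix_def mat_delete_def)
    ultimately show ?thesis
      using M k by (simp add: char_poly_matrix B_def adj_mat_def cofactor_def)
  qed
  have ai: "a $ i \<noteq> 0"
  proof -
    have "mat_delete A i i \<in> carrier_mat (N - 1) (N - 1)" using A mat_delete_carrier by blast
    then show ?thesis
      using del char_del[OF i] B i by (auto simp: eigenvalue_root_char_poly a_def)
  qed
  have diag: "a $ i * B $$ (w, w) = a $ w * a $ w" if w: "w < N" for w
  proof -
    have "r $ i = a $ i" using B i by (simp add: r_def a_def)
    then have "r $ w = a $ w" using proportional[OF a r Mr w] ai by simp
    moreover have "r $ w = col B w $ i" using B i w by (simp add: r_def)
    moreover have "a $ i * col B w $ w = col B w $ i * a $ w"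
      using B w by (intro proportional a col) auto
    ultimately show ?thesis using B w by simp
  qed
  \<comment> \<open>The derivative is the sum of the characteristic polynomials of the matrices
    \<open>mat_delete A w w\<close>; at \<open>x\<close> this is the trace of \<open>B\<close>. The
    factor \<open>a $ i\<close> prepares for \<open>diag\<close>.\<close>
  have "a $ i * poly (pderiv (char_poly A)) x = (\<Sum>w<N. a $ i * B $$ (w, w))"
    by (simp add: pderiv_char_poly[OF A] poly_sum sum_distrib_left char_del)
  also have "\<dots> = (\<Sum>w<N. a $ w * a $ w)" by (simp add: diag)
  also have "\<dots> \<noteq> 0"
    using i ai by (subst sum_nonneg_eq_0_iff) auto
  finally have der: "poly (pderiv (char_poly A)) x \<noteq> 0" by auto
  then have "pderiv (char_poly A) \<noteq> 0" by auto
  moreover have "char_poly A \<noteq> 0" using der by auto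
  ultimately have "Polynomial.order x (char_poly A) = Suc (Polynomial.order x (pderiv (char_poly A)))"
    using root by (intro order_pderiv) (auto simp: order_root)
  then show ?thesis using der by (simp add: order_0I)
qed

section \<open>Eigenfunctions and downer vertices\<close>

definition eigenfunction :: "('a, 'b) pre_digraph \<Rightarrow> real \<Rightarrow> ('a \<Rightarrow> real) \<Rightarrow> bool" where
  "eigenfunction G x f \<longleftrightarrow> (\<forall>w\<in>verts G. (\<Sum>w' | w \<rightarrow>\<^bsub>G\<^esub> w'. f w') = x * f w)"

lemma eigenfunction_iff_adjacency_matrix:
  assumes "wf_digraph G" "distinct vs" "set vs = verts G"
  shows "eigenfunction G x f \<longleftrightarrow> adjacency_matrix vs G *\<^sub>v vec (length vs) (\<lambda>i. f (vs ! i))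
    = x \<cdot>\<^sub>v vec (length vs) (\<lambda>i. f (vs ! i))" (is "_ \<longleftrightarrow> ?A *\<^sub>v ?y = x \<cdot>\<^sub>v ?y")
proof -
  have sum: "(?A *\<^sub>v ?y) $ i = (\<Sum>w' | vs ! i \<rightarrow>\<^bsub>G\<^esub> w'. f w')" if i: "i < length vs" for i
  proof -
    have "(?A *\<^sub>v ?y) $ i = (\<Sum>j = 0..<length vs. (if vs ! i \<rightarrow>\<^bsub>G\<^esub> vs ! j then f (vs ! j) else 0))"
      using i by (auto simp: adjacency_matrix_def scalar_prod_def intro!: sum.cong)
    also have "\<dots> = (\<Sum>w'\<in>verts G. if vs ! i \<rightarrow>\<^bsub>G\<^esub> w' then f w' else 0)"
      using bij_betw_nth[OF assms(2), of "{0..<length vs}" "verts G"] assms(3)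
      by (intro sum.reindex_bij_betw) (auto simp: lessThan_atLeast0)
    also have "\<dots> = (\<Sum>w'\<in>{w' \<in> verts G. vs ! i \<rightarrow>\<^bsub>G\<^esub> w'}. f w')"
      by (subst sum.inter_filter) (simp_all flip: assms(3))
    also have "{w' \<in> verts G. vs ! i \<rightarrow>\<^bsub>G\<^esub> w'} = {w'. vs ! i \<rightarrow>\<^bsub>G\<^esub> w'}"
      using wf_digraph.adj_in_verts(2)[OF assms(1)] by blast
    finally show ?thesis .
  qed
  have "?A *\<^sub>v ?y = x \<cdot>\<^sub>v ?y \<longleftrightarrow> (\<forall>i<length vs. (?A *\<^sub>v ?y) $ i = (x \<cdot>\<^sub>v ?y) $ i)"
    by (auto simp: vec_eq_iff adjacency_matrix_def)
  also have "\<dots> \<longleftrightarrow> (\<forall>i<length vs. (\<Sum>w' | vs ! i \<rightarrow>\<^bsub>G\<^esub> w'. f w') = x * f (vs ! i))"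
    using sum by auto
  also have "\<dots> \<longleftrightarrow> eigenfunction G x f"
    unfolding eigenfunction_def assms(3)[symmetric] by (simp add: all_set_conv_all_nth)
  finally show ?thesis by simp
qed

lemma vec_eq_function_on_list:
  assumes "distinct vs" "y \<in> carrier_vec (length vs)"
  obtains f where "y = vec (length vs) (\<lambda>i. f (vs ! i))"
proof
  show "y = vec (length vs) (\<lambda>i. y $ inv_into {..<length vs} ((!) vs) (vs ! i))"
    using assms by (intro eq_vecI) (auto simp: inv_into_f_f inj_on_nth)
qed

lemma graph_eigenvalue_iff_eigenfunction:
  assumes "fin_digraph G"
  shows "graph_eigenvalue G x \<longleftrightarrow> (\<exists>f. eigenfunction G x f \<and> (\<exists>w\<in>verts G. f w \<noteq> 0))"
proof -
  interpret fin_digraph G by fact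
  define vs where "vs = vertex_enum G"
  have vs: "distinct vs" "set vs = verts G"
    using vertex_enum[OF finite_verts] by (simp_all add: vs_def)
  have nz: "vec (length vs) (\<lambda>i. f (vs ! i)) \<noteq> 0\<^sub>v (length vs) \<longleftrightarrow> (\<exists>w\<in>verts G. f w \<noteq> 0)"
    for f :: "'a \<Rightarrow> real"
    unfolding vs(2)[symmetric] by (auto simp: vec_eq_iff set_conv_nth)
  have dim: "dim_row (adjacency_matrix vs G) = length vs" by (simp add: adjacency_matrix_def)
  note eq = eigenfunction_iff_adjacency_matrix[OF wf_digraph_axioms vs]
  show ?thesis
  proof
    assume "graph_eigenvalue G x"
    then obtain y where "y \<in> carrier_vec (length vs)" "y \<noteq> 0\<^sub>v (length vs)"
      "adjacency_matrix vs G *\<^sub>v y = x \<cdot>\<^sub>v y"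
      using graph_eigenvalue_eq[OF vs] by (auto simp: eigenvalue_def eigenvector_def dim)
    then show "\<exists>f. eigenfunction G x f \<and> (\<exists>w\<in>verts G. f w \<noteq> 0)"
      by (metis vec_eq_function_on_list[OF vs(1)] nz eq)
  next
    assume "\<exists>f. eigenfunction G x f \<and> (\<exists>w\<in>verts G. f w \<noteq> 0)"
    then obtain f where "eigenfunction G x f" "\<exists>w\<in>verts G. f w \<noteq> 0" by blast
    then have "eigenvector (adjacency_matrix vs G) (vec (length vs) (\<lambda>i. f (vs ! i))) x"
      using nz eq by (simp add: eigenvector_def dim)
    then show "graph_eigenvalue G x"
      using graph_eigenvalue_eq[OF vs] by (auto simp: eigenvalue_def)
  qed
qed

lemma adjacent_del_vert_iff:
  "w \<rightarrow>\<^bsub>pre_digraph.del_vert G v\<^esub> w' \<longleftrightarrow> w \<rightarrow>\<^bsub>G\<^esub> w' \<and> w \<noteq> v \<and> w' \<noteq> v"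
  by (auto simp: arcs_ends_def arc_to_ends_def pre_digraph.del_vert_def)

text \<open>The multiplicity falls from 1 in \<open>G\<close> to 0 in G - v. The second fact is
  proved first, since it also supplies the nonzero diagonal cofactor needed for simplicity.\<close>

lemma downer_vertex_if_eigenfunctions_nonzero_at:
  assumes "graph G" and v: "v \<in> verts G" and ev: "graph_eigenvalue G x"
    and nz: "\<And>f. \<lbrakk>eigenfunction G x f; f v = 0\<rbrakk> \<Longrightarrow> \<forall>w\<in>verts G. f w = 0"
  shows "downer_vertex G x v"
proof -
  interpret graph G by fact
  let ?H = "pre_digraph.del_vert G v"
  obtain g where g: "eigenfunction G x g" "g v \<noteq> 0"
    using ev nz graph_eigenvalue_iff_eigenfunction[OF fin_digraph_axioms] by blast
  have fin: "finite {w'. w \<rightarrow>\<^bsub>G\<^esub> w'}" for w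
    by (rule finite_subset[OF _ finite_verts]) (auto dest: adj_in_verts)
  have not_ev: "\<not> graph_eigenvalue ?H x"
  proof
    assume "graph_eigenvalue ?H x"
    then obtain f where f: "eigenfunction ?H x f" "\<exists>w\<in>verts ?H. f w \<noteq> 0"
      using graph_eigenvalue_iff_eigenfunction[OF fin_digraph_del_vert] by blast
    \<comment> \<open>The eigenequations in \<open>?H\<close> do not constrain \<open>f v\<close>;
      the value 0 cancels the contribution of \<open>v\<close> to neighbour sums in
      \<open>G\<close>.\<close>
    define f0 where "f0 = f(v := 0)"
    have f0: "(\<Sum>w' | w \<rightarrow>\<^bsub>G\<^esub> w'. f0 w') = x * f0 w" if w: "w \<in> verts G" "w \<noteq> v" for w
    proof -
      have "(\<Sum>w' | w \<rightarrow>\<^bsub>G\<^esub> w'. f0 w') = (\<Sum>w' | w \<rightarrow>\<^bsub>?H\<^esub> w'. f w')"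
        using w by (intro sum.mono_neutral_cong_right fin)
          (auto simp: adjacent_del_vert_iff f0_def)
      then show ?thesis using f(1) w by (auto simp: eigenfunction_def verts_del_vert f0_def)
    qed
    \<comment> \<open>The eigenequation of \<open>f0\<close> can only fail at \<open>v\<close>, but by symmetry its defect is
      orthogonal to \<open>g\<close>, and \<open>g v \<noteq> 0\<close>.\<close>
    let ?d = "\<lambda>w. (\<Sum>w' | w \<rightarrow>\<^bsub>G\<^esub> w'. f0 w') - x * f0 w"
    have adj: "(\<Sum>w' | w \<rightarrow>\<^bsub>G\<^esub> w'. k w') = (\<Sum>w'\<in>verts G. if w \<rightarrow>\<^bsub>G\<^esub> w' then k w' else 0)"
      for k :: "'a \<Rightarrow> real" and w
      by (subst sum.inter_filter[symmetric]) (auto intro!: sum.cong dest: adj_in_verts)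
    have "(\<Sum>w\<in>verts G. g w * (\<Sum>w' | w \<rightarrow>\<^bsub>G\<^esub> w'. f0 w'))
        = (\<Sum>w\<in>verts G. \<Sum>w'\<in>verts G. if w \<rightarrow>\<^bsub>G\<^esub> w' then g w * f0 w' else 0)"
      unfolding adj sum_distrib_left by (intro sum.cong) auto
    also have "\<dots> = (\<Sum>w'\<in>verts G. \<Sum>w\<in>verts G. if w \<rightarrow>\<^bsub>G\<^esub> w' then g w * f0 w' else 0)"
      by (rule sum.swap)
    also have "\<dots> = (\<Sum>w'\<in>verts G. f0 w' * (\<Sum>w | w' \<rightarrow>\<^bsub>G\<^esub> w. g w))"
      unfolding adj sum_distrib_left
      by (intro sum.cong refl) (use arcs_ends_conv symmetric_conv sym_arcs in \<open>auto simp: symmetric_def dest: symD\<close>)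
    also have "\<dots> = (\<Sum>w'\<in>verts G. g w' * (x * f0 w'))"
      using g(1) by (intro sum.cong) (auto simp: eigenfunction_def)
    finally have "(\<Sum>w\<in>verts G. g w * ?d w) = 0"
      by (simp add: right_diff_distrib sum_subtractf)
    also have "(\<Sum>w\<in>verts G. g w * ?d w) = (\<Sum>w\<in>{v}. g w * ?d w)"
      using v f0 by (intro sum.mono_neutral_right) auto
    finally have "?d v = 0" using g(2) by simp
    then have "eigenfunction G x f0"
      using f0 unfolding eigenfunction_def by (metis eq_iff_diff_eq_0)
    then have "\<forall>w\<in>verts G. f0 w = 0" by (rule nz) (simp add: f0_def)
    then show False using f(2) by (auto simp: f0_def verts_del_vert split: if_splits)
  qed
  define ws where "ws = vertex_enum ?H"
  have ws: "distinct ws" "set ws = verts ?H"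
    using vertex_enum[OF fin_digraph.finite_verts[OF fin_digraph_del_vert]] by (simp_all add: ws_def)
  \<comment> \<open>With \<open>v\<close> at index 0, deleting row and column 0 leaves exactly the
    adjacency matrix of \<open>?H\<close> for \<open>ws\<close>.\<close>
  define vs where "vs = v # ws"
  have vs: "distinct vs" "set vs = verts G"
    using ws v by (auto simp: vs_def verts_del_vert)
  let ?A = "adjacency_matrix vs G"
  have del: "mat_delete ?A 0 0 = adjacency_matrix ws ?H"
  proof -
    have "ws ! i \<noteq> v" if "i < length ws" for i
      using ws(2) nth_mem[OF that] by (auto simp: verts_del_vert)
    then show ?thesis
      by (intro eq_matI) (auto simp: mat_delete_def adjacency_matrix_def vs_def adjacent_del_vert_iff)
  qed
  have "Polynomial.order x (char_poly ?A) = 1"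
  proof (rule simple_eigenvalue_if_eigenvectors_nonzero_at)
    show "?A \<in> carrier_mat (length vs) (length vs)" by simp
    show "0 < length vs" by (simp add: vs_def)
    show "?A\<^sup>T = ?A"
      using sym_arcs by (intro eq_matI) (auto simp: adjacency_matrix_def symmetric_def dest: symD)
    show "eigenvalue ?A x" using ev graph_eigenvalue_eq[OF vs] by simp
    show "\<not> eigenvalue (mat_delete ?A 0 0) x"
      using not_ev graph_eigenvalue_eq[OF ws] by (simp add: del)
    fix y assume y: "y \<in> carrier_vec (length vs)" "?A *\<^sub>v y = x \<cdot>\<^sub>v y" "y $ 0 = 0"
    obtain f where f: "y = vec (length vs) (\<lambda>i. f (vs ! i))"
      using vec_eq_function_on_list[OF vs(1) y(1)] .
    have "f v = 0" using y(3) by (simp add: f vs_def)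
    moreover have "eigenfunction G x f"
      using y(2) eigenfunction_iff_adjacency_matrix[OF wf_digraph_axioms vs] f by simp
    ultimately have "\<forall>w\<in>set vs. f w = 0" using nz vs(2) by simp
    then show "y = 0\<^sub>v (length vs)" by (auto simp: f)
  qed
  then have "eigenvalue_multiplicity G x = 1" using eigenvalue_multiplicity_eq[OF vs] by simp
  moreover have "eigenvalue_multiplicity ?H x = 0"
    using not_ev eigenvalue_multiplicity_eq[OF ws] graph_eigenvalue_eq[OF ws]
    by (auto simp: eigenvalue_root_char_poly[OF adjacency_matrix_carrier] intro: order_0I)
  ultimately show ?thesis using v ev by (simp add: downer_vertex_def)
qed

section \<open>Eigenfunctions of chain graphs\<close>

text \<open>Zeros spread alternately between \<open>a\<close> and \<open>b\<close>, inwards from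
  opposite ends of the chain. Only corners of \<open>a\<close> are treated: the hypotheses on the
  sums are symmetric under exchanging \<open>a\<close> with \<open>b\<close> and \<open>m\<close>
  with \<open>n\<close>.\<close>

lemma chain_recurrence_zero:
  fixes a b :: "nat \<Rightarrow> real" and m n :: "nat \<Rightarrow> nat"
  assumes x: "x \<noteq> 0" and h: "h \<ge> 1" and n: "n 1 > 0"
    and a: "\<And>i. i \<in> {1..h} \<Longrightarrow> (\<Sum>j = 1..h + 1 - i. n j * b j) = x * a i"
    and b: "\<And>j. j \<in> {1..h} \<Longrightarrow> (\<Sum>i = 1..h + 1 - j. m i * a i) = x * b j"
    and corner: "a 1 = 0 \<or> a h = 0"
    and i: "i \<in> {1..h}"
  shows "a i = 0 \<and> b i = 0"
proof -
  have first_a: "x * a h = n 1 * b 1" and first_b: "x * b h = m 1 * a 1"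
    using a[of h] b[of h] h by simp_all
  have step_a: "x * a i = x * a (i + 1) + n (h + 1 - i) * b (h + 1 - i)" if "1 \<le> i" "i < h" for i
  proof -
    have "h + 1 - i = Suc (h + 1 - (i + 1))" using that by simp
    then have "(\<Sum>j = 1..h + 1 - i. n j * b j)
        = (\<Sum>j = 1..h + 1 - (i + 1). n j * b j) + n (h + 1 - i) * b (h + 1 - i)" by simp
    then show ?thesis using a[of i] a[of "i + 1"] that by simp
  qed
  have step_b: "x * b i = x * b (i + 1) + m (h + 1 - i) * a (h + 1 - i)" if "1 \<le> i" "i < h" for i
  proof -
    have "h + 1 - i = Suc (h + 1 - (i + 1))" using that by simp
    then have "(\<Sum>j = 1..h + 1 - i. m j * a j)
        = (\<Sum>j = 1..h + 1 - (i + 1). m j * a j) + m (h + 1 - i) * a (h + 1 - i)" by simp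
    then show ?thesis using b[of i] b[of "i + 1"] that by simp
  qed
  from corner show ?thesis
  proof
    assume a1: "a 1 = 0"
    \<comment> \<open>Here \<open>a\<close> is cleared upwards and \<open>b\<close> downwards:
      \<open>step_a\<close> at k + 1 involves \<open>b (h - k)\<close>, and \<open>step_b\<close> at
      h - k - 1 involves the new zero \<open>a (k + 2)\<close>.\<close>
    have *: "a (k + 1) = 0 \<and> b (h - k) = 0" if "k < h" for k
      using that
    proof (induction k)
      case 0
      then show ?case using a1 first_b x by simp
    next
      case (Suc k)
      then have IH: "a (k + 1) = 0" "b (h - k) = 0" by auto
      have "a (k + 2) = 0" using step_a[of "k + 1"] IH x Suc.prems by simp
      moreover have "h + 1 - (h - Suc k) = k + 2" "h - Suc k + 1 = h - k" using Suc.prems by auto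
      ultimately show ?case using step_b[of "h - Suc k"] IH x Suc.prems by simp
    qed
    show ?thesis using *[of "i - 1"] *[of "h - i"] i by auto
  next
    assume ah: "a h = 0"
    \<comment> \<open>The directions are reversed. The start divides \<open>first_a\<close> by
      \<open>n 1\<close>, which is where its positivity enters.\<close>
    have *: "a (h - k) = 0 \<and> b (k + 1) = 0" if "k < h" for k
      using that
    proof (induction k)
      case 0
      then show ?case using ah first_a n by simp
    next
      case (Suc k)
      then have IH: "a (h - k) = 0" "b (k + 1) = 0" by auto
      have "b (k + 2) = 0" using step_b[of "k + 1"] IH x Suc.prems by simp
      moreover have "h + 1 - (h - Suc k) = k + 2" "h - Suc k + 1 = h - k" using Suc.prems by auto
      ultimately show ?case using step_a[of "h - Suc k"] IH x Suc.prems by simp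
    qed
    show ?thesis using *[of "i - 1"] *[of "h - i"] i by auto
  qed
qed

text \<open>Adjacency means i + j \<le> h + 1, which is symmetric in the two indices, so both colour
  classes get the same range.\<close>

lemma DNG_neighbours:
  assumes "i \<in> {1..h}"
  shows "k < m i \<Longrightarrow> {w. UVert i k \<rightarrow>\<^bsub>DNG h m n\<^esub> w} = (\<Union>j\<in>{1..h + 1 - i}. V_cell n j)"
    and "k < n i \<Longrightarrow> {w. VVert i k \<rightarrow>\<^bsub>DNG h m n\<^esub> w} = (\<Union>j\<in>{1..h + 1 - i}. U_cell m j)"
proof -
  assume k: "k < m i"
  have "UVert i k \<rightarrow>\<^bsub>DNG h m n\<^esub> w \<longleftrightarrow> w \<in> (\<Union>j\<in>{1..h + 1 - i}. V_cell n j)" for w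
    using assms k by (cases w) (auto simp: DNG_def DNG_edges_def)
  then show "{w. UVert i k \<rightarrow>\<^bsub>DNG h m n\<^esub> w} = (\<Union>j\<in>{1..h + 1 - i}. V_cell n j)" by blast
next
  assume k: "k < n i"
  have "VVert i k \<rightarrow>\<^bsub>DNG h m n\<^esub> w \<longleftrightarrow> w \<in> (\<Union>j\<in>{1..h + 1 - i}. U_cell m j)" for w
    using assms k by (cases w) (auto simp: DNG_def DNG_edges_def)
  then show "{w. VVert i k \<rightarrow>\<^bsub>DNG h m n\<^esub> w} = (\<Union>j\<in>{1..h + 1 - i}. U_cell m j)" by blast
qed

lemma eigenfunction_DNG_zero:
  assumes h: "h \<ge> 1" and m: "\<And>i. i \<in> {1..h} \<Longrightarrow> m i > 0" and n: "\<And>i. i \<in> {1..h} \<Longrightarrow> n i > 0"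
    and x: "x \<noteq> 0" and f: "eigenfunction (DNG h m n) x f"
    and v: "v \<in> U_cell m 1 \<union> U_cell m h \<union> V_cell n 1 \<union> V_cell n h" "f v = 0"
    and w: "w \<in> verts (DNG h m n)"
  shows "f w = 0"
proof -
  have verts: "verts (DNG h m n) = (\<Union>i\<in>{1..h}. U_cell m i) \<union> (\<Union>j\<in>{1..h}. V_cell n j)"
    by (simp add: DNG_def)
  define a where "a i = f (UVert i 0)" for i
  define b where "b j = f (VVert j 0)" for j
  have sumU: "x * f (UVert i k) = (\<Sum>j = 1..h + 1 - i. \<Sum>l<n j. f (VVert j l))"
    if "i \<in> {1..h}" "k < m i" for i k
  proof -
    have "UVert i k \<in> verts (DNG h m n)" using that by (auto simp: verts)
    then have "x * f (UVert i k) = sum f {w. UVert i k \<rightarrow>\<^bsub>DNG h m n\<^esub> w}"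
      using f by (simp add: eigenfunction_def)
    also have "\<dots> = sum f (\<Union>j\<in>{1..h + 1 - i}. V_cell n j)"
      using DNG_neighbours(1)[of i h k m n] that by simp
    also have "\<dots> = (\<Sum>j = 1..h + 1 - i. sum f (V_cell n j))"
      by (rule sum.UNION_disjoint) (auto simp: V_cell_def)
    also have "\<dots> = (\<Sum>j = 1..h + 1 - i. \<Sum>l<n j. f (VVert j l))"
      by (simp add: V_cell_def sum.reindex inj_on_def)
    finally show ?thesis .
  qed
  have sumV: "x * f (VVert i k) = (\<Sum>j = 1..h + 1 - i. \<Sum>l<m j. f (UVert j l))"
    if "i \<in> {1..h}" "k < n i" for i k
  proof -
    have "VVert i k \<in> verts (DNG h m n)" using that by (auto simp: verts)
    then have "x * f (VVert i k) = sum f {w. VVert i k \<rightarrow>\<^bsub>DNG h m n\<^esub> w}"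
      using f by (simp add: eigenfunction_def)
    also have "\<dots> = sum f (\<Union>j\<in>{1..h + 1 - i}. U_cell m j)"
      using DNG_neighbours(2)[of i h k n m] that by simp
    also have "\<dots> = (\<Sum>j = 1..h + 1 - i. sum f (U_cell m j))"
      by (rule sum.UNION_disjoint) (auto simp: U_cell_def)
    also have "\<dots> = (\<Sum>j = 1..h + 1 - i. \<Sum>l<m j. f (UVert j l))"
      by (simp add: U_cell_def sum.reindex inj_on_def)
    finally show ?thesis .
  qed
  \<comment> \<open>The right-hand side of \<open>sumU\<close> does not depend on \<open>k\<close>,
    and \<open>x\<close> can be cancelled.\<close>
  have constU: "f (UVert i k) = a i" if "i \<in> {1..h}" "k < m i" for i k
    using sumU[of i k] sumU[of i 0] that m[of i] x unfolding a_def by (metis mult_left_cancel)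
  have constV: "f (VVert i k) = b i" if "i \<in> {1..h}" "k < n i" for i k
    using sumV[of i k] sumV[of i 0] that n[of i] x unfolding b_def by (metis mult_left_cancel)
  have recU: "(\<Sum>j = 1..h + 1 - i. n j * b j) = x * a i" if "i \<in> {1..h}" for i
  proof -
    have "(\<Sum>l<n j. f (VVert j l)) = n j * b j" if "j \<in> {1..h + 1 - i}" for j
      using constV[of j] that \<open>i \<in> {1..h}\<close> by auto
    then show ?thesis using sumU[of i 0] m[of i] that by (simp add: a_def)
  qed
  have recV: "(\<Sum>j = 1..h + 1 - i. m j * a j) = x * b i" if "i \<in> {1..h}" for i
  proof -
    have "(\<Sum>l<m j. f (UVert j l)) = m j * a j" if "j \<in> {1..h + 1 - i}" for j
      using constU[of j] that \<open>i \<in> {1..h}\<close> by auto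
    then show ?thesis using sumV[of i 0] n[of i] that by (simp add: b_def)
  qed
  have "(a 1 = 0 \<or> a h = 0) \<or> (b 1 = 0 \<or> b h = 0)"
    using v h constU constV by (auto simp: U_cell_def V_cell_def)
  moreover have m1: "m 1 > 0" and n1: "n 1 > 0" using h m n by auto
  \<comment> \<open>The second instance exchanges the two colour classes, to cover a zero in a
    corner cell of \<open>V\<close>.\<close>
  ultimately have zero: "a i = 0 \<and> b i = 0" if "i \<in> {1..h}" for i
    using chain_recurrence_zero[where a = a and b = b and m = m and n = n, OF x h n1 recU recV _ that]
      chain_recurrence_zero[where a = b and b = a and m = n and n = m, OF x h m1 recV recU _ that]
    by blast
  show ?thesis
    using w zero constU constV unfolding verts by (auto simp: U_cell_def V_cell_def)
qed

theorem theorem3p5: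
  fixes h :: nat and m n :: "nat \<Rightarrow> nat" and x :: real and v :: dng_vertex
  assumes "h \<ge> 1"
    and "\<And>i. i \<in> {1..h} \<Longrightarrow> m i > 0"
    and "\<And>i. i \<in> {1..h} \<Longrightarrow> n i > 0"
    and "graph_eigenvalue (DNG h m n) x" and "x \<noteq> 0"
    and "v \<in> U_cell m 1 \<union> U_cell m h \<union> V_cell n 1 \<union> V_cell n h"
  shows "downer_vertex (DNG h m n) x v"
proof (rule downer_vertex_if_eigenfunctions_nonzero_at[OF graph_DNG _ assms(4)])
  show "v \<in> verts (DNG h m n)" using assms(1,6) by (auto simp: DNG_def)
  show "\<forall>w\<in>verts (DNG h m n). f w = 0" if "eigenfunction (DNG h m n) x f" "f v = 0" for f
    using eigenfunction_DNG_zero[OF assms(1-3,5) that(1) assms(6) that(2)] by blast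
qed

end
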